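(* Let $X$ and $Y$ be compact $n$-dimensional polyhedra and let $f\colon X\to Y$ be a non-degenerate PL map. Then $f$ is a PL $(n+1)$-prem; that is, there exists a map $g\colon X\to\mathbb{R}^{n+1}$ such that $f\times g\colon X\to Y\times\mathbb{R}^{n+1}$, $x\mapsto(f(x),g(x))$, is a PL embedding.
   Context: A PL map is non-degenerate if it has no point-inverses of dimension $>0$. *)

theory Defs
  imports "HOL-Analysis.Analysis"
begin

text \<open>
  The library's \<^const>\<open>polyhedron\<close> means a finite intersection of half-spaces. A compact
  polyhedron in the sense of PL topology is the body of a finite simplicial complex. The
  library's \<^const>\<open>simplicial_complex\<close> is finite by definition, and it may contain the empty
  set, which is the simplex of dimension \<open>-1\<close>.
\<close>

definition triangulates :: "'a::euclidean_space set set \<Rightarrow> 'a set \<Rightarrow> bool" where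
  "triangulates K X \<longleftrightarrow> simplicial_complex K \<and> \<Union>K = X"

definition compact_polyhedron :: "'a::euclidean_space set \<Rightarrow> bool" where
  "compact_polyhedron X \<longleftrightarrow> (\<exists>K. triangulates K X)"

text \<open>
  The largest dimension of a simplex contained in \<open>X\<close>. The set below always contains \<open>-1\<close> and is
  bounded by the dimension of the ambient space. Lemma \<open>pl_dim_triangulates\<close> shows that this is the
  dimension of every complex triangulating \<open>X\<close>.
\<close>

definition pl_dim :: "'a::euclidean_space set \<Rightarrow> int" where
  "pl_dim X = Max {k. \<exists>S. k simplex S \<and> S \<subseteq> X}"

text \<open>
  A map is PL on a compact polyhedron if it is affine on each simplex of some triangulation; it is
  then continuous, since the simplices are finitely many closed sets.
\<close>

definition pl_on :: "'a::euclidean_space set \<Rightarrow> ('a \<Rightarrow> 'b::euclidean_space) \<Rightarrow> bool" where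
  "pl_on X f \<longleftrightarrow>
     (\<exists>K. triangulates K X \<and>
          (\<forall>S\<in>K. \<exists>L c. linear L \<and> (\<forall>x\<in>S. f x = L x + c)))"

definition pl_map :: "'a::euclidean_space set \<Rightarrow> 'b::euclidean_space set \<Rightarrow> ('a \<Rightarrow> 'b) \<Rightarrow> bool" where
  "pl_map X Y f \<longleftrightarrow> pl_on X f \<and> f ` X \<subseteq> Y"

definition pl_nondegenerate ::
    "'a::euclidean_space set \<Rightarrow> 'b::euclidean_space set \<Rightarrow> ('a \<Rightarrow> 'b) \<Rightarrow> bool" where
  "pl_nondegenerate X Y f \<longleftrightarrow> \<not> (\<exists>y\<in>Y. pl_dim {x\<in>X. f x = y} > 0)"

text \<open>
  A PL embedding is a PL homeomorphism onto its image. The condition \<open>pl_map (f ` X) X h\<close> includes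
  that the image is a compact polyhedron.
\<close>

definition pl_embedding :: "'a::euclidean_space set \<Rightarrow> 'b::euclidean_space set \<Rightarrow> ('a \<Rightarrow> 'b) \<Rightarrow> bool" where
  "pl_embedding X Z f \<longleftrightarrow>
     pl_map X Z f \<and> (\<exists>h. pl_map (f ` X) X h \<and> homeomorphism X (f ` X) f h)"

lemma convex_subset_finite_Union_affine:
  fixes S :: "'a::euclidean_space set"
  assumes "finite A" "convex S" "S \<noteq> {}" "S \<subseteq> \<Union>A" "\<And>T. T \<in> A \<Longrightarrow> affine T"
  shows "\<exists>T\<in>A. S \<subseteq> T"
  using assms
proof (induction A rule: finite_induct)
  case empty
  then show ?case by auto
next
  case (insert T A)
  show ?case
  proof (rule ccontr)
    assume neg: "\<not> ?case"
    then have "\<not> S \<subseteq> \<Union>A"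
      using insert by auto
    then obtain y where y: "y \<in> S" "y \<notin> \<Union>A" by blast
    from neg obtain x where x: "x \<in> S" "x \<notin> T" by blast
    have "y \<in> T" using y insert.prems by auto
    then have "x \<noteq> y" using x by auto
    have line: "B \<supseteq> {x, y}"
      if B: "affine B" "p \<in> B" "q \<in> B" "p \<noteq> q" "p \<in> closed_segment x y" "q \<in> closed_segment x y"
      for B p q
    proof -
      obtain s t where p: "p = (1 - s) *\<^sub>R x + s *\<^sub>R y" and q: "q = (1 - t) *\<^sub>R x + t *\<^sub>R y"
        using B(5,6) unfolding closed_segment_def by blast
      have "s \<noteq> t" using B(4) p q by auto
      have comb: "(1 - u) *\<^sub>R p + u *\<^sub>R q \<in> B" for u
        using B(1-3) by (simp add: affine_alt)
      have pq: "(1 - u) *\<^sub>R p + u *\<^sub>R q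
          = (1 - (s + u * (t - s))) *\<^sub>R x + (s + u * (t - s)) *\<^sub>R y" for u
        unfolding p q by (simp add: algebra_simps)
      have "(s + (- s / (t - s)) * (t - s)) = 0" "(s + ((1 - s) / (t - s)) * (t - s)) = 1"
        using \<open>s \<noteq> t\<close> by (auto simp: field_simps)
      then have "x \<in> B" "y \<in> B"
        using comb[of "- s / (t - s)"] comb[of "(1 - s) / (t - s)"] unfolding pq by simp_all
      then show ?thesis by simp
    qed
    have "finite (B \<inter> closed_segment x y)" if "B \<in> insert T A" for B
    proof -
      have "\<not> {x, y} \<subseteq> B" using that x y by auto
      then have "p = q" if "p \<in> B \<inter> closed_segment x y" "q \<in> B \<inter> closed_segment x y" for p q
        using line[of B p q] insert.prems(4)[OF \<open>B \<in> insert T A\<close>] that by blast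
      then have "B \<inter> closed_segment x y \<subseteq> {SOME p. p \<in> B \<inter> closed_segment x y}"
        by (metis (no_types, lifting) singletonI someI subsetI)
      then show ?thesis using finite_subset by blast
    qed
    then have "finite (\<Union>B\<in>insert T A. B \<inter> closed_segment x y)"
      using insert.hyps by blast
    moreover have "closed_segment x y \<subseteq> (\<Union>B\<in>insert T A. B \<inter> closed_segment x y)"
      using closed_segment_subset[OF x(1) y(1) \<open>convex S\<close>] insert.prems(3) by blast
    ultimately have "finite (closed_segment x y)"
      using finite_subset by blast
    then show False using \<open>x \<noteq> y\<close> by simp
  qed
qed

lemma pl_dim_triangulates:
  assumes "triangulates K X" "K \<noteq> {}"
  shows "pl_dim X = Max (aff_dim ` K)"
proof -
  have fin: "finite K" and simp: "\<And>S. S \<in> K \<Longrightarrow> \<exists>n. n simplex S" and X: "\<Union>K = X"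
    using assms by (auto simp: triangulates_def simplicial_complex_def)
  let ?D = "{k. \<exists>S. k simplex S \<and> S \<subseteq> X}"
  have sub: "aff_dim ` K \<subseteq> ?D"
    using simp X aff_dim_simplex by blast
  have ub: "k \<le> Max (aff_dim ` K)" if k: "k \<in> ?D" for k
  proof -
    obtain S where S: "k simplex S" "S \<subseteq> X" using k by blast
    have "\<exists>T\<in>K. aff_dim S \<le> aff_dim T"
    proof (cases "S = {}")
      case True
      then show ?thesis using assms(2) by (auto simp: aff_dim_geq)
    next
      case False
      have "S \<subseteq> \<Union>((hull) affine ` K)"
        using S X hull_subset[of _ affine] by blast
      moreover have "affine T" if "T \<in> (hull) affine ` K" for T :: "'a set"
        using that by auto
      ultimately obtain T where "T \<in> K" "S \<subseteq> affine hull T"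
        using convex_subset_finite_Union_affine[of "(hull) affine ` K" S] False fin convex_simplex[OF S(1)]
        by auto
      then show ?thesis using aff_dim_subset[of S "affine hull T"] by auto
    qed
    then show ?thesis
      using fin aff_dim_simplex[OF S(1)] by (meson Max_ge finite_imageI image_eqI order_trans)
  qed
  have "?D \<subseteq> {-1..int DIM('a)}"
    using simplex_dim_ge aff_dim_simplex aff_dim_le_DIM by fastforce
  then have "finite ?D" using finite_subset by blast
  moreover have "Max (aff_dim ` K) \<in> ?D"
    using Max_in[of "aff_dim ` K"] sub fin assms(2) by blast
  ultimately show ?thesis
    unfolding pl_dim_def using ub by (intro Max_eqI) blast+
qed

end

theory Submission
  imports Defs
begin

text \<open>
  The map \<open>g\<close> can be taken to be the restriction of a linear map of the ambient space, and any
  sufficiently general linear map works. Let \<open>f\<close> be affine on the simplices of a complex \<open>K\<close>. Non-degeneracy makes \<open>f\<close>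
  injective on each simplex, since otherwise a whole segment would be collapsed to one point. Hence,
  for simplices \<open>S\<close> and \<open>T\<close> of \<open>K\<close>, a pair \<open>x \<in> S\<close>, \<open>y \<in> T\<close> with \<open>f x = f y\<close> is determined by \<open>x\<close>: the
  point \<open>y\<close>, and so also \<open>x - y\<close>, is an affine function of \<open>x\<close>. As \<open>S\<close> has dimension at most \<open>n\<close>, the
  differences \<open>x - y\<close> span a subspace of dimension at most \<open>n + 1\<close>
  (\<open>fiber_differences_in_small_subspace\<close>). There are finitely many such subspaces, one for each pair
  \<open>(S, T)\<close>, and some linear map to \<open>(n + 1)\<close>-space is injective on all of them
  (\<open>linear_injective_on_small_subspaces\<close>). With this \<open>g\<close>, from \<open>f x = f y\<close> and \<open>g x = g y\<close> it follows
  that \<open>x - y\<close> is in the kernel of \<open>g\<close> and in one of these subspaces, so \<open>x = y\<close>.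

  Thus \<open>f \<times> g\<close> is injective, and it is affine on the simplices of \<open>K\<close> itself. Such a map is a PL
  embedding: it carries \<open>K\<close> to a simplicial complex, on whose simplices the inverse is again affine
  (\<open>pl_embedding_if_affine_on_complex\<close>).
\<close>

section \<open>Linear maps in general position\<close>

text \<open>
  The coordinates of \<open>x\<close> are added to the map one at a time. When the coordinate \<open>x \<bullet> v\<close> is added with
  the coefficient vector \<open>w\<close>, the kernel has a vector \<open>x \<in> W\<close> with \<open>x \<bullet> v \<noteq> 0\<close> only if \<open>w\<close> is in a
  certain affine subspace of the target. This subspace is proper, because the map
  \<open>x \<mapsto> (x \<bullet> v, g x)\<close> cannot send \<open>W\<close>, whose dimension is at most that of the target, onto a space
  of one dimension more. Finitely many proper affine subspaces do not cover the target.
\<close>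

lemma linear_injective_on_small_subspaces:
  fixes \<W> :: "'a::euclidean_space set set"
  assumes "finite \<W>" and sub: "\<And>W. W \<in> \<W> \<Longrightarrow> subspace W"
    and dim: "\<And>W. W \<in> \<W> \<Longrightarrow> dim W \<le> DIM('c::euclidean_space)"
  shows "\<exists>g :: 'a \<Rightarrow> 'c. linear g \<and> (\<forall>W\<in>\<W>. inj_on g W)"
proof -
  have "\<exists>g :: 'a \<Rightarrow> 'c. linear g \<and> (\<forall>W\<in>\<W>. \<forall>x\<in>W. g x = 0 \<longrightarrow> (\<forall>b\<in>B. x \<bullet> b = 0))"
    if "finite B" for B :: "'a set"
    using that
  proof (induction B rule: finite_induct)
    case empty
    then show ?case
      using linear_zero by auto
  next
    case (insert v B)
    then obtain g :: "'a \<Rightarrow> 'c" where g: "linear g"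
      and ker: "\<And>W x. W \<in> \<W> \<Longrightarrow> x \<in> W \<Longrightarrow> g x = 0 \<Longrightarrow> \<forall>b\<in>B. x \<bullet> b = 0"
      by blast
    interpret g: linear g by fact
    \<comment> \<open>Kernel vectors in \<open>W\<close> with nonzero coordinate along \<open>v\<close> can be scaled to have coordinate \<open>1\<close>.\<close>
    define bad where "bad W = {w. \<exists>x\<in>W. x \<bullet> v = 1 \<and> g x + w = 0}" for W
    have aff: "affine (bad W)" if "W \<in> \<W>" for W
      unfolding affine_def
    proof (intro ballI allI impI)
      fix w1 w2 and s t :: real
      assume "w1 \<in> bad W" "w2 \<in> bad W" and st: "s + t = 1"
      then obtain x y where x: "x \<in> W" "x \<bullet> v = 1" "w1 = - g x"
        and y: "y \<in> W" "y \<bullet> v = 1" "w2 = - g y"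
        unfolding bad_def by (auto simp: eq_neg_iff_add_eq_0 add.commute)
      have "s *\<^sub>R x + t *\<^sub>R y \<in> W"
        using sub[OF that] x y by (simp add: subspace_add subspace_scale)
      then show "s *\<^sub>R w1 + t *\<^sub>R w2 \<in> bad W"
        unfolding bad_def using x y st
        by (intro CollectI bexI[of _ "s *\<^sub>R x + t *\<^sub>R y"])
          (auto simp: inner_add_left g.add g.scale)
    qed
    have proper: "bad W \<noteq> UNIV" if W: "W \<in> \<W>" for W
    proof
      assume UN: "bad W = UNIV"
      define \<phi> where "\<phi> x = (x \<bullet> v, g x)" for x
      have lin: "linear \<phi>"
        unfolding \<phi>_def
        by (rule linearI) (auto simp: inner_add_left g.add g.scale)
      have sub\<phi>: "subspace (\<phi> ` W)"
        using lin sub[OF W] by (rule linear_subspace_image)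
      have one: "(1, w) \<in> \<phi> ` W" for w
      proof -
        have "- w \<in> bad W" using UN by simp
        then obtain x where "x \<in> W" "x \<bullet> v = 1" "g x = w"
          unfolding bad_def by auto
        then show ?thesis unfolding \<phi>_def by force
      qed
      have "(r, w) \<in> \<phi> ` W" for r w
      proof -
        have "r *\<^sub>R (1, 0) + ((1, w) - (1, 0)) \<in> \<phi> ` W"
          using sub\<phi> one by (intro subspace_add subspace_diff subspace_scale)
        then show ?thesis by simp
      qed
      then have "\<phi> ` W = UNIV" by auto
      then have "dim (\<phi> ` W) = 1 + DIM('c)"
        by (simp add: dim_UNIV)
      then show False
        using dim_image_le[OF lin, of W] dim[OF W] by simp
    qed
    have "\<exists>w. w \<notin> \<Union>(bad ` \<W>)"
    proof (rule ccontr)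
      assume "\<not> ?thesis"
      then have "\<exists>T\<in>bad ` \<W>. UNIV \<subseteq> T"
        using \<open>finite \<W>\<close> aff by (intro convex_subset_finite_Union_affine) auto
      then show False using proper by auto
    qed
    then obtain w where w: "\<And>W. W \<in> \<W> \<Longrightarrow> w \<notin> bad W" by blast
    define g' where "g' x = g x + (x \<bullet> v) *\<^sub>R w" for x
    have "linear g'"
      unfolding g'_def
      by (rule linearI) (auto simp: inner_add_left g.add g.scale algebra_simps)
    moreover have "\<forall>b\<in>insert v B. x \<bullet> b = 0" if W: "W \<in> \<W>" "x \<in> W" and 0: "g' x = 0" for W x
    proof -
      have "x \<bullet> v = 0"
      proof (rule ccontr)
        assume nz: "x \<bullet> v \<noteq> 0"
        have "g ((1 / (x \<bullet> v)) *\<^sub>R x) + w = (1 / (x \<bullet> v)) *\<^sub>R g' x"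
          unfolding g'_def using nz by (simp add: g.scale scaleR_add_right)
        then have "w \<in> bad W"
          unfolding bad_def using nz 0 W sub
          by (intro CollectI bexI[of _ "(1 / (x \<bullet> v)) *\<^sub>R x"]) (auto simp: subspace_scale)
        then show False using w W by blast
      qed
      then show ?thesis using 0 ker[OF W] by (simp add: g'_def)
    qed
    ultimately show ?case by blast
  qed
  from this[OF finite_Basis] obtain g :: "'a \<Rightarrow> 'c" where g: "linear g"
    and ker: "\<And>W x. W \<in> \<W> \<Longrightarrow> x \<in> W \<Longrightarrow> g x = 0 \<Longrightarrow> \<forall>b\<in>Basis. x \<bullet> b = 0"
    by blast
  have "inj_on g W" if "W \<in> \<W>" for W
    unfolding linear_inj_on_iff_eq_0[OF g sub[OF that]]
    using ker[OF that] euclidean_all_zero_iff by metis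
  then show ?thesis using g by blast
qed

section \<open>Maps that are affine and injective on a convex set\<close>

abbreviation affine_map_on :: "'a::euclidean_space set \<Rightarrow> ('a \<Rightarrow> 'b::euclidean_space) \<Rightarrow> bool" where
  "affine_map_on S f \<equiv> \<exists>L c. linear L \<and> (\<forall>x\<in>S. f x = L x + c)"

text \<open>
  The linear part of \<open>f\<close> may have a kernel, but not in the directions of the affine hull of \<open>S\<close>: a
  kernel vector in such a direction could be scaled so that it leads from a relative interior point
  of \<open>S\<close> to another point of \<open>S\<close>.
\<close>

lemma affine_map_on_left_inverse:
  fixes f :: "'a::euclidean_space \<Rightarrow> 'b::euclidean_space"
  assumes "affine_map_on S f" and "convex S" and inj: "inj_on f S"
  shows "\<exists>L c. linear L \<and> (\<forall>x\<in>S. x = L (f x) + c)"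
proof (cases "S = {}")
  case True
  then show ?thesis using linear_zero by auto
next
  case False
  obtain L c where L: "linear L" and f: "\<And>x. x \<in> S \<Longrightarrow> f x = L x + c"
    using assms(1) by blast
  interpret L: linear L by fact
  obtain a where a: "a \<in> rel_interior S"
    using False \<open>convex S\<close> rel_interior_eq_empty by blast
  then obtain e where "a \<in> S" "e > 0" and e: "cball a e \<inter> affine hull S \<subseteq> S"
    unfolding mem_rel_interior_cball by blast
  let ?V = "span ((\<lambda>x. - a + x) ` S)"
  have hull: "affine hull S = (\<lambda>x. a + x) ` ?V"
    using \<open>a \<in> S\<close> by (intro affine_hull_span_gen) (simp add: hull_inc)
  have "z = 0" if z: "z \<in> ?V" "L z = 0" for z
  proof (rule ccontr)
    assume nz: "z \<noteq> 0"
    let ?y = "(e / norm z) *\<^sub>R z"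
    have "a + ?y \<in> affine hull S"
      unfolding hull using z(1) by (intro imageI span_scale)
    moreover have "a + ?y \<in> cball a e"
      using nz \<open>e > 0\<close> by (simp add: dist_norm)
    ultimately have "a + ?y \<in> S" using e by blast
    moreover from this have "f (a + ?y) = f a"
      using f \<open>a \<in> S\<close> z(2) by (simp add: L.add L.scale)
    ultimately have "a + ?y = a"
      using inj \<open>a \<in> S\<close> by (meson inj_onD)
    then show False using nz \<open>e > 0\<close> by simp
  qed
  then have "inj_on L ?V"
    using linear_inj_on_iff_eq_0[OF L subspace_span] by blast
  then obtain M where M: "linear M" and M_L: "\<And>v. v \<in> ?V \<Longrightarrow> M (L v) = v"
    using linear_exists_left_inverse_on[OF L subspace_span] by blast
  have "x = M (f x) + (a - M (f a))" if "x \<in> S" for x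
  proof -
    have "M (f x) - M (f a) = M (L (- a + x))"
      using f[OF that] f[OF \<open>a \<in> S\<close>]
      by (simp add: linear_diff[OF M, symmetric] L.diff)
    also have "\<dots> = x - a"
      using that by (subst M_L) (auto intro: span_base)
    finally show ?thesis by (simp add: algebra_simps)
  qed
  then show ?thesis using M by blast
qed

lemma aff_dim_affine_map_image_le:
  fixes f :: "'a::euclidean_space \<Rightarrow> 'b::euclidean_space"
  assumes "affine_map_on S f"
  shows "aff_dim (f ` S) \<le> aff_dim S"
proof -
  obtain L c where L: "linear L" and f: "\<And>x. x \<in> S \<Longrightarrow> f x = L x + c"
    using assms by blast
  have "f ` S = (\<lambda>x. c + x) ` L ` S"
    using f by (auto simp: image_iff add.commute)
  then show ?thesis
    using aff_dim_linear_image_le[OF L] by (simp add: aff_dim_translation_eq)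
qed

lemma affine_map_on_in_segment:
  assumes "affine_map_on S f" and "a \<in> S" "b \<in> S" "(1 - t) *\<^sub>R a + t *\<^sub>R b \<in> S"
  shows "f ((1 - t) *\<^sub>R a + t *\<^sub>R b) = (1 - t) *\<^sub>R f a + t *\<^sub>R f b"
proof -
  obtain L c where "linear L" and f: "\<And>x. x \<in> S \<Longrightarrow> f x = L x + c"
    using assms(1) by blast
  interpret L: linear L by fact
  show ?thesis
    unfolding f[OF assms(2)] f[OF assms(3)] f[OF assms(4)]
    by (simp add: L.add L.diff L.scale algebra_simps)
qed

text \<open>
  The vertices stay affinely independent because the affine left inverse maps their images back to
  them, and an affine map does not raise the dimension.
\<close>

lemma simplex_affine_map_image:
  fixes f :: "'a::euclidean_space \<Rightarrow> 'b::euclidean_space"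
  assumes S: "k simplex S" and aff: "affine_map_on S f" and inj: "inj_on f S"
  shows "k simplex (f ` S)"
proof -
  obtain C where C: "finite C" "\<not> affine_dependent C" "int (card C) = k + 1" "S = convex hull C"
    using S unfolding simplex by blast
  obtain L c where L: "linear L" and f: "\<And>x. x \<in> S \<Longrightarrow> f x = L x + c"
    using aff by blast
  have "C \<subseteq> S" using C(4) by (simp add: hull_subset)
  obtain M d where "linear M" and M: "\<And>x. x \<in> S \<Longrightarrow> x = M (f x) + d"
    using affine_map_on_left_inverse[OF aff convex_simplex[OF S] inj] by blast
  have card: "card (f ` C) = card C"
    using inj \<open>C \<subseteq> S\<close> by (meson card_image inj_on_subset)
  have "(\<lambda>y. M y + d) ` f ` C = C"
    using M \<open>C \<subseteq> S\<close> by (force simp: image_image)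
  moreover have "aff_dim ((\<lambda>y. M y + d) ` f ` C) \<le> aff_dim (f ` C)"
    using \<open>linear M\<close> by (intro aff_dim_affine_map_image_le) blast
  ultimately have "aff_dim C \<le> aff_dim (f ` C)" by simp
  then have indep: "\<not> affine_dependent (f ` C)"
    using C card aff_dim_le_card[of "f ` C"] affine_independent_iff_card[of C]
    unfolding affine_independent_iff_card by simp
  have "f ` A = (\<lambda>x. c + x) ` L ` A" if "A \<subseteq> S" for A
    using f that by (auto simp: image_iff add.commute subset_iff)
  then have "f ` S = convex hull (f ` C)"
    using C(4) \<open>C \<subseteq> S\<close> by (simp add: convex_hull_translation convex_hull_linear_image[OF L])
  then show ?thesis
    unfolding simplex_def using indep card C(3) by auto
qed

text \<open>
  Being a face is a condition on segments and on convexity. Injectivity on the whole of \<open>S\<close> lets the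
  condition on segments be read back from the image, and the left inverse does so for convexity.
\<close>

lemma face_of_affine_map_image:
  fixes f :: "'a::euclidean_space \<Rightarrow> 'b::euclidean_space"
  assumes "convex S" and aff: "affine_map_on S f" and inj: "inj_on f S" and "A \<subseteq> S"
  shows "f ` A face_of f ` S \<longleftrightarrow> A face_of S"
proof -
  have seg: "f x \<in> open_segment (f a) (f b) \<longleftrightarrow> x \<in> open_segment a b"
    if "a \<in> S" "b \<in> S" "x \<in> S" for a b x
  proof
    assume "x \<in> open_segment a b"
    then show "f x \<in> open_segment (f a) (f b)"
      using that affine_map_on_in_segment[OF aff that(1,2)] inj
      by (auto simp: in_segment inj_on_eq_iff)
  next
    assume "f x \<in> open_segment (f a) (f b)"
    then obtain t where t: "0 < t" "t < 1" "f a \<noteq> f b" "f x = (1 - t) *\<^sub>R f a + t *\<^sub>R f b"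
      by (auto simp: in_segment)
    have "(1 - t) *\<^sub>R a + t *\<^sub>R b \<in> S"
      using \<open>convex S\<close> that t by (simp add: convex_alt)
    moreover from this have "f ((1 - t) *\<^sub>R a + t *\<^sub>R b) = f x"
      using affine_map_on_in_segment[OF aff that(1,2)] t by simp
    ultimately have "x = (1 - t) *\<^sub>R a + t *\<^sub>R b"
      using inj that by (metis inj_onD)
    then show "x \<in> open_segment a b"
      using t by (auto simp: in_segment)
  qed
  obtain L c where L: "linear L" and f: "\<And>x. x \<in> S \<Longrightarrow> f x = L x + c"
    using aff by blast
  obtain M d where M: "linear M" and id: "\<And>x. x \<in> S \<Longrightarrow> x = M (f x) + d"
    using affine_map_on_left_inverse[OF aff \<open>convex S\<close> inj] by blast
  have "f ` A = (\<lambda>x. c + x) ` L ` A"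
    using f \<open>A \<subseteq> S\<close> by (auto simp: image_iff add.commute subset_iff)
  moreover have "A = (\<lambda>x. d + x) ` M ` f ` A"
    using id \<open>A \<subseteq> S\<close> by (force simp: image_iff add.commute subset_iff)
  ultimately have "convex (f ` A) \<longleftrightarrow> convex A"
    using L M by (metis convex_linear_image convex_translation)
  moreover have "(\<forall>a\<in>f ` S. \<forall>b\<in>f ` S. \<forall>x\<in>f ` A. x \<in> open_segment a b \<longrightarrow> a \<in> f ` A \<and> b \<in> f ` A)
      \<longleftrightarrow> (\<forall>a\<in>S. \<forall>b\<in>S. \<forall>x\<in>A. x \<in> open_segment a b \<longrightarrow> a \<in> A \<and> b \<in> A)"
    unfolding ball_simps(9)
    by (intro ball_cong refl)
      (simp add: seg subsetD[OF \<open>A \<subseteq> S\<close>] inj_on_image_mem_iff[OF inj _ \<open>A \<subseteq> S\<close>])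
  ultimately show ?thesis
    unfolding face_of_def using \<open>A \<subseteq> S\<close> by (simp add: image_mono)
qed

section \<open>Piecewise affine embeddings\<close>

text \<open>
  Injectivity on single simplices would not suffice: it is injectivity on the union that makes the
  images of two simplices meet exactly in the image of their common face.
\<close>

lemma simplicial_complex_affine_map_image:
  fixes f :: "'a::euclidean_space \<Rightarrow> 'b::euclidean_space"
  assumes K: "simplicial_complex K" and aff: "\<And>S. S \<in> K \<Longrightarrow> affine_map_on S f"
    and inj: "inj_on f (\<Union>K)"
  shows "simplicial_complex ((`) f ` K)"
proof -
  have simp: "\<And>S. S \<in> K \<Longrightarrow> \<exists>k. k simplex S"
    and faces: "\<And>F S. S \<in> K \<Longrightarrow> F face_of S \<Longrightarrow> F \<in> K"
    and int: "\<And>S T. S \<in> K \<Longrightarrow> T \<in> K \<Longrightarrow> S \<inter> T face_of S"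
    and "finite K"
    using K unfolding simplicial_complex_def by auto
  have injS: "inj_on f S" if "S \<in> K" for S
    using inj that by (meson Union_upper inj_on_subset)
  have face: "f ` A face_of f ` S \<longleftrightarrow> A face_of S" if "S \<in> K" "A \<subseteq> S" for A S
    using that simp convex_simplex by (intro face_of_affine_map_image aff injS) blast+
  have "\<exists>k. k simplex (f ` S)" if "S \<in> K" for S
    using simp[OF that] simplex_affine_map_image[OF _ aff injS] that by blast
  moreover have "F \<in> (`) f ` K" if S: "S \<in> K" and F: "F face_of f ` S" for F S
  proof -
    obtain A where "A \<subseteq> S" "F = f ` A"
      using face_of_imp_subset[OF F] by (meson subset_imageE)
    then show ?thesis
      using face[OF S] faces[OF S] F by blast
  qed
  moreover have "f ` S \<inter> f ` T face_of f ` S" if "S \<in> K" "T \<in> K" for S T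
  proof -
    have "f ` S \<inter> f ` T = f ` (S \<inter> T)"
      using inj that by (intro inj_on_image_Int[symmetric]) auto
    then show ?thesis
      using face[of S "S \<inter> T"] int that by simp
  qed
  ultimately show ?thesis
    unfolding simplicial_complex_def using \<open>finite K\<close> by auto
qed

text \<open>
  Each of the two triangulations required by a PL embedding is at hand: \<open>K\<close> for \<open>f\<close>, and the image of
  \<open>K\<close>, whose simplices are carried back by affine maps, for the inverse.
\<close>

lemma pl_embedding_if_affine_on_complex:
  fixes f :: "'a::euclidean_space \<Rightarrow> 'b::euclidean_space"
  assumes K: "triangulates K X" and aff: "\<And>S. S \<in> K \<Longrightarrow> affine_map_on S f"
    and inj: "inj_on f X" and "f ` X \<subseteq> Z"
  shows "pl_embedding X Z f"
proof -
  have cplx: "simplicial_complex K" and X: "\<Union>K = X"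
    using K by (auto simp: triangulates_def)
  have "finite K" and simp: "\<And>S. S \<in> K \<Longrightarrow> \<exists>k. k simplex S"
    using cplx by (auto simp: simplicial_complex_def)
  have "compact X"
    using \<open>finite K\<close> simp compact_simplex X by (metis compact_Union)
  have "continuous_on S f" if S: "S \<in> K" for S
  proof -
    obtain L c where "linear L" and f: "\<And>x. x \<in> S \<Longrightarrow> f x = L x + c"
      using aff[OF S] by blast
    then have "continuous_on S (\<lambda>x. L x + c)"
      by (intro continuous_intros linear_continuous_on) (simp add: linear_conv_bounded_linear)
    then show ?thesis using f by simp
  qed
  then have "continuous_on (\<Union>S\<in>K. S) f"
    using \<open>finite K\<close> simp closed_simplex by (intro continuous_on_closed_Union) blast+
  then obtain h where h: "homeomorphism X (f ` X) f h"
    using homeomorphism_compact[OF \<open>compact X\<close>] inj X by auto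
  have "triangulates ((`) f ` K) (f ` X)"
    unfolding triangulates_def
    using simplicial_complex_affine_map_image[OF cplx aff] inj X by auto
  moreover have "affine_map_on (f ` S) h" if S: "S \<in> K" for S
  proof -
    have "S \<subseteq> X" using S X by blast
    then obtain M d where "linear M" "\<And>x. x \<in> S \<Longrightarrow> x = M (f x) + d"
      using affine_map_on_left_inverse[OF aff[OF S]] simp[OF S] convex_simplex inj inj_on_subset
      by metis
    moreover have "h (f x) = x" if "x \<in> S" for x
      using h that \<open>S \<subseteq> X\<close> by (auto simp: homeomorphism_def)
    ultimately show ?thesis by (metis imageE)
  qed
  ultimately have "pl_on (f ` X) h"
    unfolding pl_on_def by blast
  moreover have "pl_on X f"
    unfolding pl_on_def using K aff by blast
  moreover have "h ` f ` X \<subseteq> X"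
    using h by (auto simp: homeomorphism_def)
  ultimately show ?thesis
    unfolding pl_embedding_def pl_map_def using h \<open>f ` X \<subseteq> Z\<close> by blast
qed

section \<open>Fibers of non-degenerate maps\<close>

lemma simplex_dim_le_pl_dim:
  fixes S :: "'a::euclidean_space set"
  assumes "k simplex S" "S \<subseteq> X"
  shows "k \<le> pl_dim X"
proof -
  have "{k. \<exists>S. k simplex S \<and> S \<subseteq> X} \<subseteq> {-1..int DIM('a)}"
    using simplex_dim_ge aff_dim_simplex aff_dim_le_DIM by fastforce
  then have "finite {k. \<exists>S. k simplex S \<and> S \<subseteq> X}"
    using finite_subset by blast
  then show ?thesis
    unfolding pl_dim_def using assms by (intro Max_ge) blast+
qed

text \<open>
  If \<open>f\<close> identifies two points of \<open>S\<close>, then it is constant on the segment between them, and that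
  segment is a 1-simplex in a point-inverse.
\<close>

lemma pl_nondegenerate_inj_on:
  fixes f :: "'a::euclidean_space \<Rightarrow> 'b::euclidean_space"
  assumes nondeg: "pl_nondegenerate X Y f" and "f ` X \<subseteq> Y"
    and "convex S" "S \<subseteq> X" and aff: "affine_map_on S f"
  shows "inj_on f S"
proof (rule inj_onI, rule ccontr)
  fix x y
  assume x: "x \<in> S" and y: "y \<in> S" and eq: "f x = f y" and "x \<noteq> y"
  have "closed_segment x y \<subseteq> {z \<in> X. f z = f x}"
  proof
    fix z assume z: "z \<in> closed_segment x y"
    then have "z \<in> S"
      using closed_segment_subset[OF x y \<open>convex S\<close>] by blast
    moreover obtain t where "z = (1 - t) *\<^sub>R x + t *\<^sub>R y"
      using z by (auto simp: in_segment)
    ultimately have "f z = (1 - t) *\<^sub>R f x + t *\<^sub>R f y"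
      using affine_map_on_in_segment[OF aff x y] by blast
    then have "f z = f x"
      using eq by (simp add: algebra_simps)
    then show "z \<in> {z \<in> X. f z = f x}" using \<open>z \<in> S\<close> \<open>S \<subseteq> X\<close> by blast
  qed
  then have "1 \<le> pl_dim {z \<in> X. f z = f x}"
    using one_simplex_segment[OF \<open>x \<noteq> y\<close>] by (rule simplex_dim_le_pl_dim[rotated])
  moreover have "f x \<in> Y" using x assms(2,4) by blast
  ultimately show False
    using nondeg unfolding pl_nondegenerate_def by force
qed

text \<open>
  Composing \<open>f\<close> on \<open>S\<close> with the affine inverse of \<open>f\<close> on \<open>T\<close> expresses \<open>x - y\<close> as an affine function
  of \<open>x \<in> S\<close>. The linear span of its image has at most one dimension more than \<open>S\<close>.
\<close>

lemma fiber_differences_in_small_subspace: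
  fixes f :: "'a::euclidean_space \<Rightarrow> 'b::euclidean_space"
  assumes "affine_map_on S f" and "affine_map_on T f" "convex T" "inj_on f T"
  shows "\<exists>W. subspace W \<and> int (dim W) \<le> aff_dim S + 1 \<and>
           (\<forall>x\<in>S. \<forall>y\<in>T. f x = f y \<longrightarrow> x - y \<in> W)"
proof -
  obtain L c where L: "linear L" and f: "\<And>x. x \<in> S \<Longrightarrow> f x = L x + c"
    using assms(1) by blast
  obtain M d where M: "linear M" and id: "\<And>y. y \<in> T \<Longrightarrow> y = M (f y) + d"
    using affine_map_on_left_inverse[OF assms(2-4)] by blast
  define \<delta> where "\<delta> x = x - (M (f x) + d)" for x
  have "linear (\<lambda>x. x - M (L x))"
    using linear_compose_sub[OF linear_ident linear_compose[OF L M]] by (simp add: o_def)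
  moreover have "\<delta> x = (x - M (L x)) + (- M c - d)" if "x \<in> S" for x
    unfolding \<delta>_def f[OF that] by (simp add: linear_add[OF M])
  ultimately have "affine_map_on S \<delta>" by blast
  then have "aff_dim (\<delta> ` S) \<le> aff_dim S"
    by (rule aff_dim_affine_map_image_le)
  moreover have "int (dim (\<delta> ` S)) = aff_dim (insert 0 (\<delta> ` S))"
    using aff_dim_zero[of "insert 0 (\<delta> ` S)"] dim_span[of "insert 0 (\<delta> ` S)"]
    by (simp add: hull_inc)
  moreover have "aff_dim (insert 0 (\<delta> ` S)) \<le> aff_dim (\<delta> ` S) + 1"
    by (simp add: aff_dim_insert)
  ultimately have "int (dim (span (\<delta> ` S))) \<le> aff_dim S + 1" by simp
  moreover have "x - y \<in> span (\<delta> ` S)" if "x \<in> S" "y \<in> T" "f x = f y" for x y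
  proof -
    have "x - y = \<delta> x"
      unfolding \<delta>_def using id[OF that(2)] that(3) by simp
    then show ?thesis using that(1) by (simp add: span_base)
  qed
  ultimately show ?thesis
    using subspace_span by blast
qed

section \<open>The embedding\<close>

theorem theorem2:
  fixes X :: "'a::euclidean_space set" and Y :: "'b::euclidean_space set"
    and f :: "'a \<Rightarrow> 'b" and n :: nat
  assumes "compact_polyhedron X" and "pl_dim X = int n"
    and "compact_polyhedron Y" and "pl_dim Y = int n"
    and "pl_map X Y f" and "pl_nondegenerate X Y f"
    and "CARD('m::finite) = n + 1"
  shows "\<exists>g :: 'a \<Rightarrow> real ^ 'm. pl_embedding X (Y \<times> UNIV) (\<lambda>x. (f x, g x))"
proof -
  obtain K where K: "triangulates K X" and aff: "\<And>S. S \<in> K \<Longrightarrow> affine_map_on S f"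
    and fX: "f ` X \<subseteq> Y"
    using assms(5) unfolding pl_map_def pl_on_def by blast
  have "finite K" and X: "\<Union>K = X" and simp: "\<And>S. S \<in> K \<Longrightarrow> \<exists>k. k simplex S"
    using K by (auto simp: triangulates_def simplicial_complex_def)
  have sub: "S \<subseteq> X" if "S \<in> K" for S
    using that X by blast
  have conv: "convex S" if "S \<in> K" for S
    using simp[OF that] convex_simplex by blast
  have inj: "inj_on f S" if "S \<in> K" for S
    using pl_nondegenerate_inj_on[OF assms(6) fX conv sub aff] that by blast
  have dim: "aff_dim S \<le> int n" if "S \<in> K" for S
    using simp[OF that] simplex_dim_le_pl_dim[OF _ sub[OF that]] aff_dim_simplex assms(2) by metis
  have "\<forall>S\<in>K. \<forall>T\<in>K. \<exists>W. subspace W \<and> dim W \<le> n + 1 \<and>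
      (\<forall>x\<in>S. \<forall>y\<in>T. f x = f y \<longrightarrow> x - y \<in> W)"
  proof (intro ballI)
    fix S T assume "S \<in> K" "T \<in> K"
    then obtain W where "subspace W" "int (dim W) \<le> aff_dim S + 1"
      "\<forall>x\<in>S. \<forall>y\<in>T. f x = f y \<longrightarrow> x - y \<in> W"
      using fiber_differences_in_small_subspace[OF aff aff conv inj] by blast
    then show "\<exists>W. subspace W \<and> dim W \<le> n + 1 \<and> (\<forall>x\<in>S. \<forall>y\<in>T. f x = f y \<longrightarrow> x - y \<in> W)"
      using dim[OF \<open>S \<in> K\<close>] by (intro exI[of _ W]) auto
  qed
  then obtain W where W: "\<And>S T. S \<in> K \<Longrightarrow> T \<in> K \<Longrightarrow> subspace (W S T) \<and> dim (W S T) \<le> n + 1"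
    and diff: "\<And>S T x y. S \<in> K \<Longrightarrow> T \<in> K \<Longrightarrow> x \<in> S \<Longrightarrow> y \<in> T \<Longrightarrow> f x = f y \<Longrightarrow> x - y \<in> W S T"
    by metis
  have "\<exists>g :: 'a \<Rightarrow> real ^ 'm. linear g \<and> (\<forall>V\<in>(\<lambda>(S, T). W S T) ` (K \<times> K). inj_on g V)"
    using W \<open>finite K\<close> assms(7) by (intro linear_injective_on_small_subspaces) auto
  then obtain g :: "'a \<Rightarrow> real ^ 'm" where g: "linear g"
    and gW: "\<And>S T. S \<in> K \<Longrightarrow> T \<in> K \<Longrightarrow> inj_on g (W S T)"
    by auto
  have "inj_on (\<lambda>x. (f x, g x)) X"
  proof (rule inj_onI)
    fix x y assume "x \<in> X" "y \<in> X" and eq: "(f x, g x) = (f y, g y)"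
    then obtain S T where ST: "S \<in> K" "T \<in> K" "x \<in> S" "y \<in> T" using X by blast
    have "x - y \<in> W S T" using diff ST eq by blast
    moreover have "0 \<in> W S T" using W ST by (simp add: subspace_0)
    moreover have "g (x - y) = g 0"
      using eq by (simp add: linear_diff[OF g] linear_0[OF g])
    ultimately have "x - y = 0" using gW[OF ST(1,2)] by (meson inj_onD)
    then show "x = y" by simp
  qed
  moreover have "affine_map_on S (\<lambda>x. (f x, g x))" if S: "S \<in> K" for S
  proof -
    obtain L c where L: "linear L" and f: "\<And>x. x \<in> S \<Longrightarrow> f x = L x + c"
      using aff[OF S] by blast
    have "linear (\<lambda>x. (L x, g x))"
      using L g by (auto simp: linear_iff)
    moreover have "\<forall>x\<in>S. (f x, g x) = (L x, g x) + (c, 0)"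
      using f by simp
    ultimately show ?thesis by blast
  qed
  ultimately have "pl_embedding X (Y \<times> UNIV) (\<lambda>x. (f x, g x))"
    using fX by (intro pl_embedding_if_affine_on_complex[OF K]) auto
  then show ?thesis by blast
qed

end
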